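(* Let $A\in\mathcal{F}^{m\times n}$, and let $M\in\mathcal{F}^{m\times m}$ be a nonsingular matrix such that the rows of $A'=MA$ form a quasi-orthonormal list of vectors. Put $G=(A')^*M\in\mathcal{F}^{n\times m}$. Then $G$ is a $\{124\}$-inverse of $A$, that is, $$AGA=A,\qquad GAG=G,\qquad (GA)^*=GA.$$ If in addition $A$ has full row rank (rank $m$), then also $(AG)^*=AG$, so that $G$ is a $\{1234\}$-inverse, i.e. the Moore-Penrose inverse, of $A$.
   Context: $\mathcal{F}$ is a subfield of $\mathbb{C}$ closed under complex conjugation (for instance $\mathcal{F}=\mathbb{C}$), and $\mathcal{F}^k$ carries the standard inner product $\langle u,v\rangle=\sum_j u_j\overline{v_j}$ and the Euclidean norm $\|u\|=\sqrt{\langle u,u\rangle}$. The superscript $*$ denotes conjugate transpose. A list of vectors is quasi-orthonormal if each vector has norm $1$ or $0$ and the vectors of norm $1$ are mutually orthogonal. The row orthonormalization procedure (ROP) of the paper left-multiplies $A$ by a sequence of nonsingular $m\times m$ matrices $M_1,M_2,\dots$, with product $M=\cdots M_2M_1$, so that the rows of $A'=MA$ form a quasi-orthonormal list. The four Penrose identities for a matrix $G$ relative to $A$ are (1) $AGA=A$, (2) $GAG=G$, (3) $(AG)^*=AG$, (4) $(GA)^*=GA$; a $\{124\}$-inverse satisfies (1), (2), (4), and a $\{1234\}$-inverse satisfies all four. *)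

theory Defs
  imports
    Complex_Main
    "HOL-Algebra.Subrings"
    "Jordan_Normal_Form.Schur_Decomposition"
    "Jordan_Normal_Form.DL_Rank"
begin

definition conj_closed_subfield :: "complex set \<Rightarrow> bool" where
  "conj_closed_subfield F \<longleftrightarrow> subfield F (class_ring :: complex ring) \<and> (\<forall>z\<in>F. cnj z \<in> F)"

text \<open>The space of \<open>m \<times> n\<close> matrices with entries in \<open>F\<close>.\<close>

definition mat_over :: "complex set \<Rightarrow> nat \<Rightarrow> nat \<Rightarrow> complex mat set" where
  "mat_over F m n = {A \<in> carrier_mat m n. elements_mat A \<subseteq> F}"

text \<open>The library product \<open>u \<bullet>c v\<close> is linear in \<open>u\<close> and conjugates \<open>v\<close>;
  \<open>v \<bullet>c v\<close> is a nonnegative real, so passing to its real part loses nothing.\<close>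

definition vec_norm2 :: "complex vec \<Rightarrow> real" where
  "vec_norm2 v = sqrt (Re (v \<bullet>c v))"

text \<open>Orthogonality is required for distinct positions, not distinct values: a list that repeats
  a unit vector is not quasi-orthonormal.\<close>

definition quasi_orthonormal :: "complex vec list \<Rightarrow> bool" where
  "quasi_orthonormal vs \<longleftrightarrow>
     (\<forall>v \<in> set vs. vec_norm2 v = 1 \<or> vec_norm2 v = 0) \<and>
     (\<forall>i < length vs. \<forall>j < length vs. i \<noteq> j \<longrightarrow>
        vec_norm2 (vs ! i) = 1 \<longrightarrow> vec_norm2 (vs ! j) = 1 \<longrightarrow> vs ! i \<bullet>c vs ! j = 0)"

definition penrose1 :: "complex mat \<Rightarrow> complex mat \<Rightarrow> bool" where
  "penrose1 A G \<longleftrightarrow> A * G * A = A"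

definition penrose2 :: "complex mat \<Rightarrow> complex mat \<Rightarrow> bool" where
  "penrose2 A G \<longleftrightarrow> G * A * G = G"

definition penrose3 :: "complex mat \<Rightarrow> complex mat \<Rightarrow> bool" where
  "penrose3 A G \<longleftrightarrow> mat_adjoint (A * G) = A * G"

definition penrose4 :: "complex mat \<Rightarrow> complex mat \<Rightarrow> bool" where
  "penrose4 A G \<longleftrightarrow> mat_adjoint (G * A) = G * A"

definition is_124_inverse :: "complex mat \<Rightarrow> complex mat \<Rightarrow> bool" where
  "is_124_inverse A G \<longleftrightarrow> G \<in> carrier_mat (dim_col A) (dim_row A) \<and>
     penrose1 A G \<and> penrose2 A G \<and> penrose4 A G"

definition is_1234_inverse :: "complex mat \<Rightarrow> complex mat \<Rightarrow> bool" where
  "is_1234_inverse A G \<longleftrightarrow> G \<in> carrier_mat (dim_col A) (dim_row A) \<and>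
     penrose1 A G \<and> penrose2 A G \<and> penrose3 A G \<and> penrose4 A G"

definition moore_penrose_inverse :: "complex mat \<Rightarrow> complex mat" where
  "moore_penrose_inverse A = (THE G. is_1234_inverse A G)"

end

(* With B = M A, quasi-orthonormality says that B B* is a diagonal 0/1 matrix whose zero entries
   sit at zero rows of B. Hence B B* B = B, and since G = B* M, the identities (1), (2), (4) for
   (A, G) become this identity, its adjoint and the hermiticity of G A = B* B. If A has full row
   rank, no row of the nonsingular M annihilates A, so B has no zero row, B B* = 1 and A G = 1. *)
theory Submission
  imports Defs
begin

section \<open>Algebra of the conjugate transpose\<close>

lemma dim_mat_adjoint [simp]:
  "dim_row (mat_adjoint A) = dim_col A" "dim_col (mat_adjoint A) = dim_row A"
  by (simp_all add: mat_adjoint_def)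

lemma mat_adjoint_carrier [simp]:
  "A \<in> carrier_mat m n \<Longrightarrow> mat_adjoint A \<in> carrier_mat n m"
  by auto

lemma index_mat_adjoint [simp]:
  assumes "i < dim_col A" "j < dim_row A"
  shows "mat_adjoint A $$ (i, j) = conjugate (A $$ (j, i))"
  using assms by (simp add: mat_adjoint_def mat_of_rows_index)

lemma mat_adjoint_adjoint [simp]: "mat_adjoint (mat_adjoint A) = A"
  by (rule eq_matI) auto

lemma mat_adjoint_mult:
  fixes A B :: "'a :: conjugatable_field mat"
  assumes A: "A \<in> carrier_mat m n" and B: "B \<in> carrier_mat n k"
  shows "mat_adjoint (A * B) = mat_adjoint B * mat_adjoint A"
proof (rule eq_matI)
  fix i j assume "i < dim_row (mat_adjoint B * mat_adjoint A)"
    and "j < dim_col (mat_adjoint B * mat_adjoint A)"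
  with A B have ij: "i < k" "j < m" by auto
  have "mat_adjoint (A * B) $$ (i, j) = (\<Sum>l<n. conjugate (A $$ (j, l) * B $$ (l, i)))"
    using A B ij by (simp add: scalar_prod_def sum_conjugate atLeast0LessThan)
  also have "\<dots> = (mat_adjoint B * mat_adjoint A) $$ (i, j)"
    using A B ij
    by (simp add: scalar_prod_def conjugate_dist_mul atLeast0LessThan mult.commute)
  finally show "mat_adjoint (A * B) $$ (i, j) = (mat_adjoint B * mat_adjoint A) $$ (i, j)" .
qed (use A B in auto)

lemma mat_adjoint_one [simp]: "mat_adjoint (1\<^sub>m n :: complex mat) = 1\<^sub>m n"
  by (rule eq_matI) auto

lemma index_mult_mat_adjoint:
  fixes A B :: "'a :: conjugatable_field mat"
  assumes "A \<in> carrier_mat m n" "B \<in> carrier_mat k n" "i < m" "j < k"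
  shows "(A * mat_adjoint B) $$ (i, j) = row A i \<bullet>c row B j"
  using assms by (simp add: scalar_prod_def)

section \<open>Matrices with entries in the subfield\<close>

lemma index_mat_over: "A \<in> mat_over F m n \<Longrightarrow> i < m \<Longrightarrow> j < n \<Longrightarrow> A $$ (i, j) \<in> F"
  by (auto simp: mat_over_def)

lemma mat_overI:
  "A \<in> carrier_mat m n \<Longrightarrow> (\<And>i j. i < m \<Longrightarrow> j < n \<Longrightarrow> A $$ (i, j) \<in> F) \<Longrightarrow> A \<in> mat_over F m n"
  by (auto simp: mat_over_def dest!: elements_matD)

lemma mat_over_carrier: "A \<in> mat_over F m n \<Longrightarrow> A \<in> carrier_mat m n"
  by (simp add: mat_over_def)

lemma mat_over_mult:
  assumes F: "conj_closed_subfield F" and A: "A \<in> mat_over F m n" and B: "B \<in> mat_over F n k"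
  shows "A * B \<in> mat_over F m k"
proof -
  have F': "subring F (class_ring :: complex ring)"
    using F by (auto simp: conj_closed_subfield_def subfield_def subdomain_def subcring_def)
  \<comment> \<open>No finiteness of \<open>S\<close> is assumed: a sum over an infinite set is 0 by
    convention, and 0 lies in \<open>F\<close>.\<close>
  have sum: "(\<Sum>l\<in>S. f l) \<in> F" if "\<And>l. l \<in> S \<Longrightarrow> f l \<in> F" for f and S :: "nat set"
    using that subringE(2,7)[OF F'] by (induction S rule: infinite_finite_induct) auto
  have "A $$ (i, l) * B $$ (l, j) \<in> F" if "i < m" "l < n" "j < k" for i l j
    using subringE(6)[OF F'] that index_mat_over[OF A] index_mat_over[OF B] by simp
  then show ?thesis
    using mat_over_carrier[OF A] mat_over_carrier[OF B]
    by (intro mat_overI) (auto simp: scalar_prod_def intro!: sum)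
qed

lemma mat_over_adjoint:
  assumes "conj_closed_subfield F" "A \<in> mat_over F m n"
  shows "mat_adjoint A \<in> mat_over F n m"
  using mat_over_carrier[OF assms(2)] index_mat_over[OF assms(2)] assms(1)
  by (intro mat_overI) (auto simp: conj_closed_subfield_def)

section \<open>Gram matrices of quasi-orthonormal rows\<close>

text \<open>The inner product is definite, so a row of norm 0 is the zero vector and every other row
  is a unit vector. This turns the condition on norms into one on vanishing rows.\<close>

lemma quasi_orthonormal_gram:
  assumes q: "quasi_orthonormal (rows B)" and B: "B \<in> carrier_mat m n" and i: "i < m" and j: "j < m"
  shows "row B i \<bullet>c row B j = (if i = j \<and> row B i \<noteq> 0\<^sub>v n then 1 else 0)"
proof -
  have r: "row B k \<in> carrier_vec n" if "k < m" for k
    using B that by auto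
  \<comment> \<open>Since \<open>v \<bullet>c v\<close> is nonnegative in the order on complex
    numbers, its imaginary part is 0, and squaring \<open>vec_norm2 v\<close> recovers it
    exactly.\<close>
  have self: "row B k \<bullet>c row B k = complex_of_real ((vec_norm2 (row B k))\<^sup>2)" for k
  proof -
    have "row B k \<bullet>c row B k \<ge> 0" by auto
    then show ?thesis
      by (auto simp: vec_norm2_def less_eq_complex_def complex_eq_iff)
  qed
  have norm: "vec_norm2 (row B k) = 1 \<or> vec_norm2 (row B k) = 0" if "k < m" for k
    using q B that by (auto simp: quasi_orthonormal_def rows_def)
  have zero: "vec_norm2 (row B k) = 0 \<longleftrightarrow> row B k = 0\<^sub>v n" if "k < m" for k
    using self[of k] conjugate_square_eq_0_vec[OF r[OF that]] by auto
  show ?thesis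
  proof (cases "i = j")
    case True
    then show ?thesis
      using self[of i] norm[OF i] zero[OF i] by auto
  next
    case False
    show ?thesis
    \<comment> \<open>Orthogonality is only postulated between unit rows; a zero row is orthogonal
      to everything anyway.\<close>
    proof (cases "row B i = 0\<^sub>v n \<or> row B j = 0\<^sub>v n")
      case True
      with r[OF i] r[OF j] False show ?thesis by auto
    next
      case nz: False
      then have "vec_norm2 (rows B ! i) = 1" "vec_norm2 (rows B ! j) = 1"
        using norm[OF i] norm[OF j] zero[OF i] zero[OF j] B i j by auto
      moreover have "i < length (rows B)" "j < length (rows B)"
        using B i j by auto
      ultimately have "rows B ! i \<bullet>c rows B ! j = 0"
        using q False unfolding quasi_orthonormal_def by blast
      then show ?thesis
        using B i j False by simp
    qed
  qed
qed

text \<open>Left multiplication by the diagonal 0/1 Gram matrix erases only rows that are already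
  zero. In other words, \<open>B\<close> is a partial isometry.\<close>

lemma quasi_orthonormal_mult_adjoint_mult:
  assumes q: "quasi_orthonormal (rows B)" and B: "B \<in> carrier_mat m n"
  shows "B * mat_adjoint B * B = B"
proof (rule eq_matI)
  fix i j assume "i < dim_row B" "j < dim_col B"
  with B have ij: "i < m" "j < n" by auto
  let ?d = "if row B i \<noteq> 0\<^sub>v n then 1 else 0 :: complex"
  have "(B * mat_adjoint B * B) $$ (i, j) = (\<Sum>k<m. (B * mat_adjoint B) $$ (i, k) * B $$ (k, j))"
    using B ij by (simp add: scalar_prod_def atLeast0LessThan)
  \<comment> \<open>The entry of the Gram matrix must stay folded, so that it is rewritten to an
    inner product of rows rather than to a sum.\<close>
  also have "\<dots> = (\<Sum>k<m. if k = i then ?d * B $$ (i, j) else 0)"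
    using quasi_orthonormal_gram[OF q B] B ij
    by (intro sum.cong) (auto simp: index_mult_mat_adjoint simp del: index_mult_mat)
  also have "\<dots> = ?d * B $$ (i, j)"
    using ij by simp
  also have "\<dots> = B $$ (i, j)"
  proof (cases "row B i = 0\<^sub>v n")
    case True
    from arg_cong[OF this, of "\<lambda>v. v $ j"] B ij show ?thesis by simp
  qed simp
  finally show "(B * mat_adjoint B * B) $$ (i, j) = B $$ (i, j)" .
qed (use B in auto)

lemma quasi_orthonormal_mult_adjoint_eq_one:
  assumes q: "quasi_orthonormal (rows B)" and B: "B \<in> carrier_mat m n"
    and nz: "\<And>i. i < m \<Longrightarrow> row B i \<noteq> 0\<^sub>v n"
  shows "B * mat_adjoint B = 1\<^sub>m m"
  using quasi_orthonormal_gram[OF q B] B nz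
  by (intro eq_matI) (auto simp: index_mult_mat_adjoint simp del: index_mult_mat(1))

section \<open>Consequences of full row rank\<close>

text \<open>The rank is the size of a maximal independent set of columns; an independent set of size
  \<open>n\<close> is a basis of the whole space.\<close>

lemma (in vec_space) full_rank_span_cols:
  assumes A: "A \<in> carrier_mat n nc" and rk: "rank A = n"
  shows "span (set (cols A)) = carrier_vec n"
proof -
  have cols: "set (cols A) \<subseteq> carrier_vec n"
    using A cols_dim by blast
  obtain S where S: "maximal S (\<lambda>T. T \<subseteq> set (cols A) \<and> lin_indpt T)"
    using maximal_exists_superset[of "set (cols A)" "\<lambda>T. T \<subseteq> set (cols A) \<and> lin_indpt T" "{}"]
    by (auto simp: lin_dep_def)
  then have sub: "S \<subseteq> set (cols A)" and li: "lin_indpt S"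
    by (auto simp: maximal_def)
  have "card S = dim"
    using rank_card_indpt[OF A S] rk dim_is_n by simp
  then have "basis S"
    using sub li cols dim_li_is_basis fin_dim finite_subset[OF sub] by auto
  then have "span S = carrier_vec n"
    by (auto simp: basis_def)
  then show ?thesis
    using span_is_monotone[OF sub] span_is_subset2[OF cols] by auto
qed

text \<open>A vector orthogonal to all columns is orthogonal to their span, here the whole space;
  testing against unit vectors shows that it vanishes. The bilinear product is used because it gives
  the entries of a matrix product.\<close>

lemma full_rank_left_kernel_trivial:
  fixes A :: "'a :: field mat"
  assumes A: "A \<in> carrier_mat m n" and rk: "vec_space.rank m A = m"
    and y: "y \<in> carrier_vec m" and yA: "\<And>j. j < n \<Longrightarrow> y \<bullet> col A j = 0"
  shows "y = 0\<^sub>v m"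
proof -
  interpret vec_space "TYPE('a)" m .
  have cols: "set (cols A) \<subseteq> carrier_vec m"
    using A cols_dim by blast
  have "y \<in> orthogonal_complement (set (cols A))"
    using y yA A by (auto simp: orthogonal_complement_def cols_def)
  then have orth: "y \<bullet> v = 0" if "v \<in> carrier_vec m" for v
    using that full_rank_span_cols[OF A rk] in_orthogonal_complement_span[OF cols]
    by (auto simp: orthogonal_complement_def)
  show ?thesis
  proof (rule eq_vecI)
    fix i assume "i < dim_vec (0\<^sub>v m :: 'a vec)"
    then show "y $ i = 0\<^sub>v m $ i"
      using orth[of "unit_vec m i"] y by simp
  qed (use y in simp)
qed

section \<open>Uniqueness of the Moore-Penrose inverse\<close>

text \<open>Penrose's argument: \<open>A * G = A * H\<close> and \<open>G * A = H * A\<close> follow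
  by taking adjoints of products of hermitian factors, and then
  \<open>G = G * A * G = H * A * H = H\<close>.\<close>

lemma is_1234_inverse_unique:
  assumes G: "is_1234_inverse A G" and H: "is_1234_inverse A H"
  shows "G = H"
proof -
  define m n where "m = dim_row A" and "n = dim_col A"
  have car [simp]: "A \<in> carrier_mat m n" "G \<in> carrier_mat n m" "H \<in> carrier_mat n m"
    using G H by (auto simp: is_1234_inverse_def m_def n_def)
  have G': "A * G * A = A" "G * A * G = G" "mat_adjoint (A * G) = A * G" "mat_adjoint (G * A) = G * A"
   and H': "A * H * A = A" "H * A * H = H" "mat_adjoint (A * H) = A * H" "mat_adjoint (H * A) = H * A"
    using G H
    by (simp_all add: is_1234_inverse_def penrose1_def penrose2_def penrose3_def penrose4_def)
  have "A * G = (A * H) * (A * G)"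
    using H'(1) assoc_mult_mat[of "A * H" m m A n G m] by (metis car mult_carrier_mat)
  \<comment> \<open>From here on the chain computes the adjoint of its left-hand side; hermiticity
    of \<open>A * G\<close> removes that adjoint at the end.\<close>
  also have "mat_adjoint \<dots> = (A * G) * (A * H)"
    using mat_adjoint_mult[of "A * H" m m "A * G" m] G'(3) H'(3) by (metis car mult_carrier_mat)
  also have "\<dots> = A * H"
    using G'(1) assoc_mult_mat[of "A * G" m m A n H m] by (metis car mult_carrier_mat)
  finally have AG: "A * G = A * H"
    using G'(3) by simp
  have "G * A = (G * A) * (H * A)"
    using H'(1) assoc_mult_mat[of G n m A n "H * A" n] assoc_mult_mat[of A m n H m A n]
    by (metis car mult_carrier_mat)
  also have "mat_adjoint \<dots> = (H * A) * (G * A)"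
    using mat_adjoint_mult[of "G * A" n n "H * A" n] G'(4) H'(4) by (metis car mult_carrier_mat)
  also have "\<dots> = H * A"
    using G'(1) assoc_mult_mat[of H n m A n "G * A" n] assoc_mult_mat[of A m n G m A n]
    by (metis car mult_carrier_mat)
  finally have GA: "G * A = H * A"
    using G'(4) by simp
  have "G = G * A * G" using G'(2) by simp
  also have "\<dots> = H * A * G" using GA by simp
  also have "\<dots> = H * (A * G)" using assoc_mult_mat[of H n m A n G m] by simp
  also have "\<dots> = H * A * H" using AG assoc_mult_mat[of H n m A n H m] by simp
  also have "\<dots> = H" using H'(2) .
  finally show ?thesis .
qed

lemma moore_penrose_inverse_eqI:
  "is_1234_inverse A G \<Longrightarrow> moore_penrose_inverse A = G"
  unfolding moore_penrose_inverse_def by (blast intro: is_1234_inverse_unique)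

section \<open>The Penrose identities for \<open>G\<close>\<close>

theorem mainTheorem2:
  fixes F :: "complex set" and m n :: nat and A M A' G :: "complex mat"
  assumes "conj_closed_subfield F"
    and "A \<in> mat_over F m n"
    and "M \<in> mat_over F m m" and "invertible_mat M"
    and "A' = M * A" and "quasi_orthonormal (rows A')"
    and "G = mat_adjoint A' * M"
  shows "G \<in> mat_over F n m \<and> is_124_inverse A G \<and>
    (vec_space.rank m A = m \<longrightarrow>
      penrose3 A G \<and> is_1234_inverse A G \<and> G = moore_penrose_inverse A)"
proof -
  have A: "A \<in> carrier_mat m n" and M: "M \<in> carrier_mat m m"
    using assms(2,3) by (simp_all add: mat_over_carrier)
  have B: "A' \<in> carrier_mat m n" and B': "mat_adjoint A' \<in> carrier_mat n m"
    using A M assms(5) by auto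
  have G: "G \<in> carrier_mat n m"
    using B' M assms(7) by auto
  obtain N where MN: "M * N = 1\<^sub>m m" and NM: "N * M = 1\<^sub>m (dim_row N)"
    using assms(4) M by (auto simp: invertible_mat_def inverts_mat_def)
  \<comment> \<open>\<open>invertible_mat\<close> fixes no size for \<open>N\<close>; comparing the
    numbers of columns in both products does.\<close>
  have N: "N \<in> carrier_mat m m"
    using arg_cong[OF MN, of dim_col] arg_cong[OF NM, of dim_col] M by auto
  with NM have NM: "N * M = 1\<^sub>m m" by simp
  \<comment> \<open>Identities that begin with \<open>A\<close> are proved after multiplication by
    \<open>M\<close> on the left, where \<open>M * A\<close> becomes \<open>A'\<close>.\<close>
  have cancel: "X = Y" if "M * X = M * Y" "X \<in> carrier_mat m k" "Y \<in> carrier_mat m k" for X Y k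
  proof -
    have "X = N * (M * X)"
      using assoc_mult_mat[OF N M that(2)] NM that(2) by simp
    also have "\<dots> = N * (M * Y)"
      using that(1) by simp
    also have "\<dots> = Y"
      using assoc_mult_mat[OF N M that(3)] NM that(3) by simp
    finally show ?thesis .
  qed
  have BBB: "A' * mat_adjoint A' * A' = A'"
    using quasi_orthonormal_mult_adjoint_mult[OF assms(6) B] .
  have GA: "G * A = mat_adjoint A' * A'"
    using assms(5,7) assoc_mult_mat[OF B' M A] by simp
  have MAG: "M * (A * G) = A' * mat_adjoint A' * M"
    using assms(5,7) assoc_mult_mat[OF M A G] assoc_mult_mat[OF B B' M] by simp
  have "M * (A * G * A) = A' * mat_adjoint A' * A'"
    using assoc_mult_mat[OF A G A] assoc_mult_mat[OF M A mult_carrier_mat[OF G A]]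
      assoc_mult_mat[OF B B' B] GA assms(5) by simp
  then have "M * (A * G * A) = M * A"
    using BBB assms(5) by simp
  then have p1: "penrose1 A G"
    unfolding penrose1_def using cancel[of "A * G * A" A n] A G by simp
  \<comment> \<open>Taking the adjoint of \<open>BBB\<close> and then multiplying by
    \<open>M\<close> on the right yields the second identity.\<close>
  have "mat_adjoint A' * A' * mat_adjoint A' = mat_adjoint A' * (A' * mat_adjoint A')"
    using assoc_mult_mat[OF B' B B'] .
  also have "\<dots> = mat_adjoint (A' * mat_adjoint A' * A')"
    using mat_adjoint_mult[OF mult_carrier_mat[OF B B'] B] mat_adjoint_mult[OF B B'] by simp
  finally have "mat_adjoint A' * A' * mat_adjoint A' = mat_adjoint A'"
    using BBB by simp
  then have "G * A * G = G"
    using GA assms(7) assoc_mult_mat[OF mult_carrier_mat[OF B' B] B' M] by simp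
  then have p2: "penrose2 A G"
    by (simp add: penrose2_def)
  have p4: "penrose4 A G"
    unfolding penrose4_def GA using mat_adjoint_mult[OF B' B] by simp
  have full: "penrose3 A G" if rk: "vec_space.rank m A = m"
  proof -
    \<comment> \<open>A zero row of \<open>A'\<close> would make the same row of \<open>M\<close>
      orthogonal to all columns of \<open>A\<close>, hence zero, contradicting the diagonal entry 1
      of \<open>M * N\<close>.\<close>
    have "row A' i \<noteq> 0\<^sub>v n" if i: "i < m" for i
    proof
      assume z: "row A' i = 0\<^sub>v n"
      have "row M i \<bullet> col A j = 0" if j: "j < n" for j
        using arg_cong[OF z, of "\<lambda>v. v $ j"] i j A M assms(5) by simp
      then have "row M i = 0\<^sub>v m"
        using full_rank_left_kernel_trivial[OF A rk, of "row M i"] i M by simp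
      then have "(M * N) $$ (i, i) = 0"
        using M N i by simp
      then show False
        using MN i by simp
    qed
    then have "A' * mat_adjoint A' = 1\<^sub>m m"
      using quasi_orthonormal_mult_adjoint_eq_one[OF assms(6) B] by blast
    then have "M * (A * G) = M * 1\<^sub>m m"
      using MAG M by simp
    then have "A * G = 1\<^sub>m m"
      using cancel[of "A * G" "1\<^sub>m m" m] A G by simp
    then show ?thesis
      by (simp add: penrose3_def)
  qed
  have "G \<in> mat_over F n m"
    using assms(1-3,5,7) by (auto intro!: mat_over_mult mat_over_adjoint)
  moreover have "is_124_inverse A G"
    using p1 p2 p4 A G by (simp add: is_124_inverse_def)
  moreover have "is_1234_inverse A G" if "vec_space.rank m A = m"
    using full[OF that] p1 p2 p4 A G by (simp add: is_1234_inverse_def)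
  ultimately show ?thesis
    using full moore_penrose_inverse_eqI by metis
qed

end
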